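(* Let $F:\ell^p\to Y$ be Fréchet differentiable on $\ell^p$ and suppose: (i) there is $L>0$ with $\|F'(x)-F'(z)\|_{\mathcal L(\ell^p,Y)}\le L\|x-z\|$ for all $x,z\in\ell^p$; (ii) there is $c>0$ with $\|F(x)-F(z)-F'(z)(x-z)\|\le c\,D_{f_p}(x,z)$ for all $x,z\in\ell^p$; (iii) there are $s>2$, $0<\varrho<\frac1{sc}$, an $f_p$-minimizing solution $x^\dagger$ and $\omega\in Y$ with $\|\omega\|\le\varrho$ and $J_p(x^\dagger)=F'(x^\dagger)^*\omega$. Put $\gamma=\frac{1-sc\varrho}{2}$. Then for all $\alpha\ge\alpha^*$ and all $h\in\ell^p$ with $\|h\|=1$, $$R_{\Phi_\alpha}(x_\alpha^\delta+t_2h,\;x_\alpha^\delta+t_1h)\;\ge\;\gamma\,\alpha\,D_{f_p}(x_\alpha^\delta+t_2h,\;x_\alpha^\delta+t_1h)$$ holds for all real $t_1,t_2$ with $|t_1|,|t_2|\le r_\alpha$, where $$r_\alpha:=\frac{2}{1+\sqrt2}\min\left\{\frac{\gamma\alpha}{3cK},\ \sqrt{\frac{\gamma\alpha}{10cL}}\right\}.$$ In particular, the function $t\mapsto\varphi_{\alpha,h}(t):=\Phi_\alpha(x_\alpha^\delta+th)$ is convex on $[-r_\alpha,r_\alpha]$.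
   Context: Fix $1<p\le2$ and $q$ with $\frac1p+\frac1q=1$. $\ell^p=\ell^p(\mathbb N)$ is the real sequence space with dual $\ell^q$ and duality product $\langle\cdot,\cdot\rangle$; $Y$ is a real Hilbert space; all norms are written $\|\cdot\|$. $F:\ell^p\to Y$ is a nonlinear operator that is sequentially closed with respect to the weak topologies of $\ell^p$ and $Y$. Let $y\in\mathrm{Rg}(F)$, $\delta>0$, and fix $y^\delta\in Y$ with $\|y-y^\delta\|\le\delta$. $f_p(x)=\frac1p\|x\|_{\ell^p}^p$; $J_p(x)=\nabla f_p(x)=(|x_i|^{p-1}\mathrm{sgn}(x_i))_{i}\in\ell^q$; Bregman distance $D_{f_p}(z,x)=f_p(z)-f_p(x)-\langle J_p(x),z-x\rangle$. An $f_p$-minimizing solution $x^\dagger$ is an element with $F(x^\dagger)=y$ and $f_p(x^\dagger)=\min\{f_p(x):F(x)=y\}$. For $\alpha>0$: $\Phi_\alpha(x)=\frac12\|F(x)-y^\delta\|^2+\frac{\alpha}{p}\|x\|_{\ell^p}^p$, $\nabla\Phi_\alpha(x)=F'(x)^*(F(x)-y^\delta)+\alpha J_p(x)\in\ell^q$, and $x_\alpha^\delta$ denotes a global minimizer of $\Phi_\alpha$ over $\ell^p$. Moreover $R_{\Phi_\alpha}(z,x):=\Phi_\alpha(z)-\Phi_\alpha(x)-\langle\nabla\Phi_\alpha(x),z-x\rangle$. With the constants of the claim: $\alpha^*:=\frac{\delta}{(s-2)\varrho}$, $A:=\left(\frac{p}{2\alpha^*}\right)^{1/p}\|F(0)-y^\delta\|^{2/p}$,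 $K:=LA+\|F'(0)\|$. If $K=0$, the quantity $\gamma\alpha/(3cK)$ is read as $+\infty$. *)

theory Defs
  imports "HOL-Analysis.Analysis"
begin

text \<open>
  Since the exponent \<open>p\<close> is a real parameter, the space of \<open>p\<close>-summable real sequences is a
  carrier set inside \<open>nat \<Rightarrow> real\<close>. Operators on it are total functions on \<open>nat \<Rightarrow> real\<close> whose
  values outside the carrier are never referred to.
\<close>

definition lp :: "real \<Rightarrow> (nat \<Rightarrow> real) set" where
  "lp p = {x. summable (\<lambda>i. \<bar>x i\<bar> powr p)}"

definition lp_norm :: "real \<Rightarrow> (nat \<Rightarrow> real) \<Rightarrow> real" where
  "lp_norm p x = (\<Sum>i. \<bar>x i\<bar> powr p) powr (1 / p)"

definition pairing :: "(nat \<Rightarrow> real) \<Rightarrow> (nat \<Rightarrow> real) \<Rightarrow> real" where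
  "pairing \<xi> x = (\<Sum>i. \<xi> i * x i)"

definition lp_bounded_linear ::
    "real \<Rightarrow> ((nat \<Rightarrow> real) \<Rightarrow> 'y::real_normed_vector) \<Rightarrow> bool" where
  "lp_bounded_linear p T \<longleftrightarrow>
     (\<forall>x\<in>lp p. \<forall>z\<in>lp p. T (\<lambda>i. x i + z i) = T x + T z) \<and>
     (\<forall>a. \<forall>x\<in>lp p. T (\<lambda>i. a * x i) = a *\<^sub>R T x) \<and>
     (\<exists>B. \<forall>x\<in>lp p. norm (T x) \<le> B * lp_norm p x)"

definition lp_onorm ::
    "real \<Rightarrow> ((nat \<Rightarrow> real) \<Rightarrow> 'y::real_normed_vector) \<Rightarrow> real" where
  "lp_onorm p T = (SUP x\<in>{x \<in> lp p. lp_norm p x \<le> 1}. norm (T x))"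

definition lp_has_derivative ::
    "real \<Rightarrow> ((nat \<Rightarrow> real) \<Rightarrow> 'y::real_normed_vector) \<Rightarrow> ((nat \<Rightarrow> real) \<Rightarrow> 'y) \<Rightarrow>
     (nat \<Rightarrow> real) \<Rightarrow> bool" where
  "lp_has_derivative p F T x \<longleftrightarrow>
     lp_bounded_linear p T \<and>
     (\<forall>\<epsilon>>0. \<exists>d>0. \<forall>z\<in>lp p. lp_norm p (z - x) < d \<longrightarrow>
        norm (F z - F x - T (z - x)) \<le> \<epsilon> * lp_norm p (z - x))"

text \<open>
  The dual of the Hilbert space is identified with the space itself via Riesz, the dual of
  \<open>lp p\<close> with \<open>lp q\<close> via the pairing (\<open>1/p + 1/q = 1\<close>); the sequence below exists and is unique
  for every bounded linear \<open>T\<close>.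
\<close>

definition lp_adjoint ::
    "real \<Rightarrow> real \<Rightarrow> ((nat \<Rightarrow> real) \<Rightarrow> 'y::real_inner) \<Rightarrow> 'y \<Rightarrow> (nat \<Rightarrow> real)" where
  "lp_adjoint p q T w = (THE \<xi>. \<xi> \<in> lp q \<and> (\<forall>x\<in>lp p. pairing \<xi> x = inner w (T x)))"

definition weakly_seq_closed ::
    "real \<Rightarrow> real \<Rightarrow> ((nat \<Rightarrow> real) \<Rightarrow> 'y::real_normed_vector) \<Rightarrow> bool" where
  "weakly_seq_closed p q F \<longleftrightarrow>
     (\<forall>X x v. (\<forall>n. X n \<in> lp p) \<longrightarrow> x \<in> lp p \<longrightarrow>
        (\<forall>\<xi>\<in>lp q. (\<lambda>n. pairing \<xi> (X n)) \<longlonglongrightarrow> pairing \<xi> x) \<longrightarrow>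
        (\<forall>g :: 'y \<Rightarrow> real. bounded_linear g \<longrightarrow> (\<lambda>n. g (F (X n))) \<longlonglongrightarrow> g v) \<longrightarrow>
        F x = v)"

definition f_pen :: "real \<Rightarrow> (nat \<Rightarrow> real) \<Rightarrow> real" where
  "f_pen p x = 1 / p * lp_norm p x powr p"

definition J_dual :: "real \<Rightarrow> (nat \<Rightarrow> real) \<Rightarrow> (nat \<Rightarrow> real)" where
  "J_dual p x = (\<lambda>i. \<bar>x i\<bar> powr (p - 1) * sgn (x i))"

text \<open>First-order Taylor remainder of \<open>\<Psi>\<close> with gradient map \<open>g\<close>, at \<open>x\<close> in direction \<open>z - x\<close>.\<close>

definition taylor_remainder ::
    "((nat \<Rightarrow> real) \<Rightarrow> real) \<Rightarrow> ((nat \<Rightarrow> real) \<Rightarrow> (nat \<Rightarrow> real)) \<Rightarrow>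
     (nat \<Rightarrow> real) \<Rightarrow> (nat \<Rightarrow> real) \<Rightarrow> real" where
  "taylor_remainder \<Psi> g z x = \<Psi> z - \<Psi> x - pairing (g x) (z - x)"

definition bregman :: "real \<Rightarrow> (nat \<Rightarrow> real) \<Rightarrow> (nat \<Rightarrow> real) \<Rightarrow> real" where
  "bregman p = taylor_remainder (f_pen p) (J_dual p)"

definition minimizing_solution ::
    "real \<Rightarrow> ((nat \<Rightarrow> real) \<Rightarrow> 'y) \<Rightarrow> 'y \<Rightarrow> (nat \<Rightarrow> real) \<Rightarrow> bool" where
  "minimizing_solution p F y x \<longleftrightarrow>
     x \<in> lp p \<and> F x = y \<and> (\<forall>z\<in>lp p. F z = y \<longrightarrow> f_pen p x \<le> f_pen p z)"

definition tikhonov ::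
    "real \<Rightarrow> ((nat \<Rightarrow> real) \<Rightarrow> 'y::real_normed_vector) \<Rightarrow> 'y \<Rightarrow> real \<Rightarrow> (nat \<Rightarrow> real) \<Rightarrow> real" where
  "tikhonov p F yd \<alpha> x = 1 / 2 * norm (F x - yd) ^ 2 + \<alpha> / p * lp_norm p x powr p"

definition tikhonov_grad ::
    "real \<Rightarrow> real \<Rightarrow> ((nat \<Rightarrow> real) \<Rightarrow> 'y::real_inner) \<Rightarrow> ((nat \<Rightarrow> real) \<Rightarrow> (nat \<Rightarrow> real) \<Rightarrow> 'y) \<Rightarrow>
     'y \<Rightarrow> real \<Rightarrow> (nat \<Rightarrow> real) \<Rightarrow> (nat \<Rightarrow> real)" where
  "tikhonov_grad p q F F' yd \<alpha> x =
     (\<lambda>i. lp_adjoint p q (F' x) (F x - yd) i + \<alpha> * J_dual p x i)"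

definition tikhonov_minimizer ::
    "real \<Rightarrow> ((nat \<Rightarrow> real) \<Rightarrow> 'y::real_normed_vector) \<Rightarrow> 'y \<Rightarrow> real \<Rightarrow> (nat \<Rightarrow> real) \<Rightarrow> bool" where
  "tikhonov_minimizer p F yd \<alpha> x \<longleftrightarrow>
     x \<in> lp p \<and> (\<forall>z\<in>lp p. tikhonov p F yd \<alpha> x \<le> tikhonov p F yd \<alpha> z)"

end

theory Submission imports Defs
begin

text \<open>
  The remainder of the Tikhonov functional splits as
  \<open>R(z, x) = 1/2 \<parallel>F z - F x\<parallel>\<^sup>2 + \<langle>F x - yd, F z - F x - F' x (z - x)\<rangle> + \<alpha> D(z, x)\<close>, so
  the nonlinearity condition gives \<open>R \<ge> (\<alpha> - c \<parallel>F x - yd\<parallel>) D\<close> and it suffices to show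
  \<open>c \<parallel>F x - yd\<parallel> \<le> (1 - \<gamma>) \<alpha>\<close>. At the minimizer the source condition yields
  \<open>\<parallel>F xa - yd\<parallel> \<le> \<delta> + 2 \<alpha> \<rho> \<le> s \<alpha> \<rho>\<close>, that is \<open>c \<parallel>F xa - yd\<parallel> \<le> (1 - 2 \<gamma>) \<alpha>\<close>. Along the line the
  mean value inequality bounds \<open>\<parallel>F x - F xa\<parallel>\<close> by \<open>(K + L r) r\<close>, and the choice of \<open>r\<close>
  makes this at most \<open>\<gamma> \<alpha> / c\<close>. Convexity follows because nonnegative remainders provide supporting lines.
\<close>

section \<open>The sequence spaces\<close>

lemma lp_zero [simp]: "(\<lambda>_. 0) \<in> lp p"
  by (simp add: lp_def)

lemma lp_norm_zero [simp]: "lp_norm p (\<lambda>_. 0) = 0"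
  by (simp add: lp_norm_def)

lemma lp_norm_nonneg [simp]: "lp_norm p x \<ge> 0"
  by (simp add: lp_norm_def)

lemma lp_scale:
  assumes "x \<in> lp p"
  shows "(\<lambda>i. a * x i) \<in> lp p"
  using assms unfolding lp_def by (simp add: abs_mult powr_mult summable_mult)

lemma lp_add:
  assumes "p > 0" "x \<in> lp p" "z \<in> lp p"
  shows "(\<lambda>i. x i + z i) \<in> lp p"
proof -
  have "summable (\<lambda>i. 2 powr p * (\<bar>x i\<bar> powr p + \<bar>z i\<bar> powr p))"
    using assms by (simp add: lp_def summable_mult summable_add)
  moreover have "norm (\<bar>x i + z i\<bar> powr p) \<le> 2 powr p * (\<bar>x i\<bar> powr p + \<bar>z i\<bar> powr p)" for i
  proof -
    let ?m = "max \<bar>x i\<bar> \<bar>z i\<bar>"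
    have "\<bar>x i + z i\<bar> powr p \<le> (2 * ?m) powr p"
      using assms(1) by (intro powr_mono2) auto
    also have "\<dots> = 2 powr p * ?m powr p"
      by (simp add: powr_mult)
    also have "\<dots> \<le> 2 powr p * (\<bar>x i\<bar> powr p + \<bar>z i\<bar> powr p)"
      by (intro mult_left_mono) (auto simp: max_def)
    finally show ?thesis by simp
  qed
  ultimately show ?thesis
    unfolding lp_def mem_Collect_eq by (blast intro: summable_comparison_test')
qed

lemma lp_diff:
  assumes "p > 0" "x \<in> lp p" "z \<in> lp p"
  shows "x - z \<in> lp p"
  using lp_add[OF assms(1,2) lp_scale[OF assms(3), of "-1"]] by (simp add: fun_diff_def)

lemma lp_norm_scale:
  assumes "p > 0" "x \<in> lp p"
  shows "lp_norm p (\<lambda>i. a * x i) = \<bar>a\<bar> * lp_norm p x"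
proof -
  have "(\<Sum>i. \<bar>a * x i\<bar> powr p) = \<bar>a\<bar> powr p * (\<Sum>i. \<bar>x i\<bar> powr p)"
    using assms(2) by (simp add: lp_def abs_mult powr_mult suminf_mult)
  moreover have "(\<Sum>i. \<bar>x i\<bar> powr p) \<ge> 0"
    using assms(2) by (auto intro: suminf_nonneg simp: lp_def)
  ultimately show ?thesis
    using assms(1) by (simp add: lp_norm_def powr_mult powr_powr)
qed

section \<open>Truncations and their convergence\<close>

definition truncate :: "nat \<Rightarrow> (nat \<Rightarrow> real) \<Rightarrow> (nat \<Rightarrow> real)" where
  "truncate n x = (\<lambda>i. if i < n then x i else 0)"

lemma truncate_powr_sums:
  "(\<lambda>i. \<bar>truncate n x i\<bar> powr p) sums (\<Sum>i<n. \<bar>x i\<bar> powr p)"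
proof -
  have "(\<lambda>i. \<bar>truncate n x i\<bar> powr p) = (\<lambda>i. if i \<in> {..<n} then \<bar>x i\<bar> powr p else 0)"
    by (auto simp: truncate_def)
  then show ?thesis
    using sums_If_finite_set[of "{..<n}" "\<lambda>i. \<bar>x i\<bar> powr p"] by simp
qed

lemma truncate_in_lp: "truncate n x \<in> lp p"
  using truncate_powr_sums by (auto simp: lp_def sums_iff)

lemma lp_norm_truncate: "lp_norm p (truncate n x) = (\<Sum>i<n. \<bar>x i\<bar> powr p) powr (1 / p)"
  using truncate_powr_sums by (metis lp_norm_def sums_unique)

lemma truncate_tendsto:
  assumes "p > 0" "x \<in> lp p"
  shows "(\<lambda>n. lp_norm p (x - truncate n x)) \<longlonglongrightarrow> 0"
proof -
  let ?S = "\<Sum>i. \<bar>x i\<bar> powr p"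
  have S: "(\<lambda>i. \<bar>x i\<bar> powr p) sums ?S"
    using assms(2) by (simp add: lp_def summable_sums)
  \<comment> \<open>At each index \<open>truncate n x\<close> or \<open>x - truncate n x\<close>
    vanishes, so the p-th powers subtract exactly and the tail norm is the p-th root of the
    remainder of a convergent series.\<close>
  have "\<bar>(x - truncate n x) i\<bar> powr p = \<bar>x i\<bar> powr p - \<bar>truncate n x i\<bar> powr p" for n i
    by (simp add: truncate_def)
  then have eq: "lp_norm p (x - truncate n x) = (?S - (\<Sum>i<n. \<bar>x i\<bar> powr p)) powr (1 / p)" for n
    using sums_diff[OF S truncate_powr_sums[of n x p]] by (simp add: lp_norm_def sums_iff)
  have "(\<lambda>n. ?S - (\<Sum>i<n. \<bar>x i\<bar> powr p)) \<longlonglongrightarrow> ?S - ?S"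
    using S unfolding sums_def by (intro tendsto_diff tendsto_const)
  moreover have "(\<Sum>i<n. \<bar>x i\<bar> powr p) \<le> ?S" for n
    using S by (intro sum_le_suminf) (auto simp: sums_iff)
  ultimately have "(\<lambda>n. (?S - (\<Sum>i<n. \<bar>x i\<bar> powr p)) powr (1 / p)) \<longlonglongrightarrow> 0 powr (1 / p)"
    using assms(1) by (intro tendsto_powr') (auto intro!: always_eventually)
  then show ?thesis
    by (simp add: eq)
qed

section \<open>Bounded linear operators and adjoints\<close>

lemma lp_bounded_linear_add:
  assumes "lp_bounded_linear p T" "x \<in> lp p" "z \<in> lp p"
  shows "T (\<lambda>i. x i + z i) = T x + T z"
  using assms by (simp add: lp_bounded_linear_def)

lemma lp_bounded_linear_scale:
  assumes "lp_bounded_linear p T" "x \<in> lp p"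
  shows "T (\<lambda>i. a * x i) = a *\<^sub>R T x"
  using assms by (simp add: lp_bounded_linear_def)

lemma lp_bounded_linear_minus:
  assumes "p > 0" "lp_bounded_linear p T" "x \<in> lp p" "z \<in> lp p"
  shows "T (x - z) = T x - T z"
  using lp_bounded_linear_add[OF assms(2,3) lp_scale[OF assms(4), of "-1"]]
    lp_bounded_linear_scale[OF assms(2,4), of "-1"]
  by (simp add: fun_diff_def)

text \<open>The Lipschitz hypothesis on the derivative is phrased through the supremum
  \<open>lp_onorm\<close> of such a difference; boundedness of the difference is what lets that
  supremum control individual values.\<close>

lemma lp_bounded_linear_diff:
  assumes "lp_bounded_linear p T" "lp_bounded_linear p U"
  shows "lp_bounded_linear p (\<lambda>h. T h - U h)"
proof -
  obtain B C where B: "\<forall>x\<in>lp p. norm (T x) \<le> B * lp_norm p x"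
    and C: "\<forall>x\<in>lp p. norm (U x) \<le> C * lp_norm p x"
    using assms unfolding lp_bounded_linear_def by blast
  have "norm (T x - U x) \<le> (B + C) * lp_norm p x" if "x \<in> lp p" for x
    using B C that norm_triangle_ineq4[of "T x" "U x"] by (fastforce simp: algebra_simps)
  then have "\<exists>B. \<forall>x\<in>lp p. norm (T x - U x) \<le> B * lp_norm p x"
    by blast
  then show ?thesis
    using assms unfolding lp_bounded_linear_def by (simp add: algebra_simps)
qed

lemma lp_onorm_bdd:
  assumes "lp_bounded_linear p T"
  shows "bdd_above ((\<lambda>x. norm (T x)) ` {x \<in> lp p. lp_norm p x \<le> 1})"
proof -
  obtain B where B: "\<And>x. x \<in> lp p \<Longrightarrow> norm (T x) \<le> B * lp_norm p x"
    using assms unfolding lp_bounded_linear_def by blast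
  have "norm (T x) \<le> \<bar>B\<bar>" if "x \<in> lp p" "lp_norm p x \<le> 1" for x
  proof -
    have "norm (T x) \<le> \<bar>B\<bar> * lp_norm p x"
      using B[OF that(1)] by (rule order_trans) (simp add: mult_right_mono)
    also have "\<dots> \<le> \<bar>B\<bar> * 1"
      using that by (intro mult_left_mono) auto
    finally show ?thesis by simp
  qed
  then show ?thesis
    by (auto intro!: bdd_aboveI)
qed

lemma lp_onorm_nonneg:
  assumes "lp_bounded_linear p T"
  shows "lp_onorm p T \<ge> 0"
proof -
  have "norm (T (\<lambda>_. 0)) \<le> lp_onorm p T"
    unfolding lp_onorm_def using lp_onorm_bdd[OF assms] by (intro cSUP_upper) auto
  then show ?thesis
    using norm_ge_zero order_trans by blast
qed

lemma lp_onorm_bound: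
  assumes "p > 0" "lp_bounded_linear p T" "x \<in> lp p"
  shows "norm (T x) \<le> lp_onorm p T * lp_norm p x"
proof (cases "lp_norm p x = 0")
  case True
  \<comment> \<open>Normalising is impossible here, but any bound \<open>B\<close> already forces
    \<open>T x\<close> to vanish.\<close>
  obtain B where "norm (T x) \<le> B * lp_norm p x"
    using assms unfolding lp_bounded_linear_def by blast
  then show ?thesis using True by simp
next
  case False
  define u where "u = (\<lambda>i. (1 / lp_norm p x) * x i)"
  have u: "u \<in> lp p" "lp_norm p u = 1"
    unfolding u_def using False lp_scale[OF assms(3)]
    by (blast, simp only: lp_norm_scale[OF assms(1,3)]) simp
  have "norm (T u) \<le> lp_onorm p T"
    unfolding lp_onorm_def using lp_onorm_bdd[OF assms(2)] u by (intro cSUP_upper) auto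
  moreover have "T u = (1 / lp_norm p x) *\<^sub>R T x"
    unfolding u_def using lp_bounded_linear_scale assms by blast
  moreover have "lp_norm p x > 0"
    using False lp_norm_nonneg[of p x] by linarith
  ultimately show ?thesis
    by (simp add: field_simps)
qed

section \<open>The adjoint as a concrete sequence\<close>

lemma truncate_Suc: "truncate (Suc n) x = (\<lambda>i. truncate n x i + x n * (if i = n then 1 else 0))"
  by (auto simp: truncate_def fun_eq_iff less_Suc_eq)

lemma unit_in_lp: "(\<lambda>i. if i = n then 1 else 0) \<in> lp p"
proof -
  have "(\<lambda>i. \<bar>if i = n then 1 else 0 :: real\<bar> powr p) = (\<lambda>i. if i = n then 1 else 0)"
    by auto
  then show ?thesis
    by (simp add: lp_def)
qed

lemma pairing_unit: "pairing \<xi> (\<lambda>i. if i = n then 1 else 0) = \<xi> n"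
proof -
  have "(\<lambda>i. \<xi> i * (if i = n then 1 else 0)) = (\<lambda>i. if i = n then \<xi> i else 0)"
    by auto
  then show ?thesis
    using sums_single[of n \<xi>] by (simp add: pairing_def sums_iff)
qed

text \<open>The values \<open>inner w (T e)\<close> at the unit sequences \<open>e\<close> satisfy
  the definite description of the adjoint: truncations converge to \<open>x\<close> and
  \<open>T\<close> is continuous, while a converse Hoelder argument puts the sequence into
  \<open>lp q\<close>. Stating the result with \<open>sums\<close> also supplies the convergence
  needed to split series later.\<close>

lemma lp_adjoint_sums:
  fixes T :: "(nat \<Rightarrow> real) \<Rightarrow> 'y::real_inner"
  assumes p: "1 < p" and q: "1 / p + 1 / q = 1" and T: "lp_bounded_linear p T"
    and x: "x \<in> lp p"
  shows "(\<lambda>i. lp_adjoint p q T w i * x i) sums inner w (T x)"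
proof -
  have q0: "q > 0"
  proof -
    have "1 / p < 1" using p by simp
    then have "1 / q > 0" using q by linarith
    then show ?thesis by simp
  qed
  \<comment> \<open>The first identity turns p-th powers of \<open>J_dual q \<xi>\<close> into q-th
    powers of \<open>\<xi>\<close>.\<close>
  have qp: "(q - 1) * p = q" "1 - 1 / p = 1 / q"
    using p q q0 by (auto simp: field_simps)
  define \<xi> where "\<xi> = (\<lambda>n. inner w (T (\<lambda>i. if i = n then 1 else 0)))"
  have fin: "(\<Sum>i<n. \<xi> i * x i) = inner w (T (truncate n x))" for n x
  proof (induction n)
    case 0
    have "T (\<lambda>i. 0 * 0) = 0"
      using lp_bounded_linear_scale[OF T, of "\<lambda>_. 0" 0] by simp
    then show ?case by (simp add: truncate_def)
  next
    case (Suc n)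
    have "T (truncate (Suc n) x) = T (truncate n x) + x n *\<^sub>R T (\<lambda>i. if i = n then 1 else 0)"
      unfolding truncate_Suc lp_bounded_linear_add[OF T truncate_in_lp lp_scale[OF unit_in_lp]]
        lp_bounded_linear_scale[OF T unit_in_lp] ..
    then show ?case
      using Suc by (simp add: inner_add_right \<xi>_def mult.commute)
  qed
  have sums: "(\<lambda>i. \<xi> i * x i) sums inner w (T x)" if "x \<in> lp p" for x
  proof -
    have bound: "norm (T x - T (truncate n x)) \<le> lp_onorm p T * lp_norm p (x - truncate n x)" for n
      using lp_onorm_bound[OF _ T lp_diff[OF _ that truncate_in_lp], of n x]
        lp_bounded_linear_minus[OF _ T that truncate_in_lp, of n x] p by simp
    have lim: "(\<lambda>n. lp_onorm p T * lp_norm p (x - truncate n x)) \<longlonglongrightarrow> 0"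
      using truncate_tendsto[OF _ that] p by (intro tendsto_mult_right_zero) auto
    have "(\<lambda>n. T x - T (truncate n x)) \<longlonglongrightarrow> 0"
      by (rule Lim_null_comparison[OF always_eventually lim]) (simp add: bound)
    then have "(\<lambda>n. T x - (T x - T (truncate n x))) \<longlonglongrightarrow> T x - 0"
      by (intro tendsto_diff tendsto_const)
    then have "(\<lambda>n. inner w (T (truncate n x))) \<longlonglongrightarrow> inner w (T x)"
      by (intro tendsto_inner tendsto_const) simp
    then show ?thesis
      by (simp add: sums_def fin)
  qed
  define M where "M = norm w * lp_onorm p T"
  have M: "M \<ge> 0"
    using lp_onorm_nonneg[OF T] by (simp add: M_def)
  \<comment> \<open>Testing with the truncations of \<open>J\<^sub>q \<xi>\<close> bounds the partial sums of \<open>\<bar>\<xi>\<bar>\<^sup>q\<close>.\<close>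
  have "(\<Sum>i<n. \<bar>\<xi> i\<bar> powr q) \<le> M powr q" for n
  proof -
    let ?S = "\<Sum>i<n. \<bar>\<xi> i\<bar> powr q"
    have S0: "?S \<ge> 0" by (simp add: sum_nonneg)
    have e1: "\<xi> i * J_dual q \<xi> i = \<bar>\<xi> i\<bar> powr q" for i
    proof (cases "\<xi> i = 0")
      case False
      have "\<xi> i * J_dual q \<xi> i = \<bar>\<xi> i\<bar> * \<bar>\<xi> i\<bar> powr (q - 1)"
        using False by (simp add: J_dual_def abs_if)
      then show ?thesis using powr_mult_base[of "\<bar>\<xi> i\<bar>" "q - 1"] by simp
    qed (simp add: J_dual_def)
    have e2: "\<bar>J_dual q \<xi> i\<bar> powr p = \<bar>\<xi> i\<bar> powr q" for i
      by (cases "\<xi> i = 0") (simp_all add: J_dual_def abs_mult abs_sgn_eq powr_powr qp)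
    have "?S = inner w (T (truncate n (J_dual q \<xi>)))"
      using fin[where n = n and x = "J_dual q \<xi>"] by (simp add: e1)
    also have "\<dots> \<le> norm w * norm (T (truncate n (J_dual q \<xi>)))"
      by (rule norm_cauchy_schwarz)
    also have "\<dots> \<le> norm w * (lp_onorm p T * lp_norm p (truncate n (J_dual q \<xi>)))"
      using lp_onorm_bound[OF _ T truncate_in_lp] p by (intro mult_left_mono) auto
    also have "\<dots> = M * ?S powr (1 / p)"
      by (simp add: lp_norm_truncate e2 M_def)
    finally have le: "?S \<le> M * ?S powr (1 / p)" .
    \<comment> \<open>Cancelling \<open>?S powr (1 / p)\<close> leaves the exponent
      \<open>1 / q\<close> by conjugacy; a vanishing sum is set apart since it cannot be
      cancelled.\<close>
    show ?thesis
    proof (cases "?S = 0")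
      case False
      then have "?S > 0" using S0 by linarith
      have "?S powr (1 / p) * ?S powr (1 / q) = ?S"
        using powr_add[of ?S "1 / p" "1 / q"] \<open>?S > 0\<close> q by simp
      then have "?S powr (1 / q) * ?S powr (1 / p) \<le> M * ?S powr (1 / p)"
        using le by (simp add: mult.commute)
      then have "?S powr (1 / q) \<le> M"
        by (rule mult_right_le_imp_le) (use \<open>?S > 0\<close> in simp)
      then have "(?S powr (1 / q)) powr q \<le> M powr q"
        using q0 by (intro powr_mono2) auto
      then show ?thesis
        using \<open>?S > 0\<close> q0 by (simp add: powr_powr)
    qed simp
  qed
  then have "\<xi> \<in> lp q"
    unfolding lp_def by (auto intro!: summableI_nonneg_bounded[where x = "M powr q"])
  then have "lp_adjoint p q T w = \<xi>"
    unfolding lp_adjoint_def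
  proof (intro the_equality conjI ballI)
    fix x assume "x \<in> lp p" then show "pairing \<xi> x = inner w (T x)"
      using sums[of x] by (simp add: pairing_def sums_iff)
  next
    \<comment> \<open>Uniqueness: the unit sequences are admissible test elements and read off the
      coordinates.\<close>
    fix \<eta> assume "\<eta> \<in> lp q \<and> (\<forall>x\<in>lp p. pairing \<eta> x = inner w (T x))"
    then have "\<eta> n = \<xi> n" for n
      using pairing_unit[of \<eta> n] unit_in_lp[of n p] by (simp add: \<xi>_def)
    then show "\<eta> = \<xi>" by auto
  qed
  then show ?thesis
    using sums[OF x] by simp
qed

text \<open>A Young-type bound: if m is the larger of the moduli of \<open>x i\<close> and
  \<open>z i\<close>, the term is at most m^(p-1) m = m^p, hence at most the sum of both p-th
  powers.\<close>

lemma J_dual_pairing_summable: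
  assumes "p > 1" "x \<in> lp p" "z \<in> lp p"
  shows "summable (\<lambda>i. J_dual p x i * z i)"
proof -
  have "summable (\<lambda>i. \<bar>x i\<bar> powr p + \<bar>z i\<bar> powr p)"
    using assms by (simp add: lp_def summable_add)
  moreover have "norm (J_dual p x i * z i) \<le> \<bar>x i\<bar> powr p + \<bar>z i\<bar> powr p" for i
  proof (cases "x i = 0 \<or> z i = 0")
    case False
    let ?m = "max \<bar>x i\<bar> \<bar>z i\<bar>"
    have "norm (J_dual p x i * z i) = \<bar>x i\<bar> powr (p - 1) * \<bar>z i\<bar>"
      using False by (simp add: J_dual_def abs_mult abs_sgn_eq)
    also have "\<dots> \<le> ?m powr (p - 1) * ?m"
      using assms(1) by (intro mult_mono powr_mono2) auto
    also have "\<dots> = ?m powr (p - 1) * ?m powr 1"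
      using False by simp
    also have "\<dots> = ?m powr p"
      using powr_mult_base[of ?m "p - 1"] by (simp add: mult.commute)
    also have "\<dots> \<le> \<bar>x i\<bar> powr p + \<bar>z i\<bar> powr p"
      by (auto simp: max_def)
    finally show ?thesis .
  qed (auto simp: J_dual_def)
  ultimately show ?thesis
    by (blast intro: summable_comparison_test')
qed

section \<open>The Tikhonov functional\<close>

lemma tikhonov_eq: "tikhonov p F yd \<alpha> x = 1 / 2 * norm (F x - yd) ^ 2 + \<alpha> * f_pen p x"
  by (simp add: tikhonov_def f_pen_def)

text \<open>Expanding the square about \<open>F x - yd\<close> produces the inner product with
  \<open>F z - F x\<close>; subtracting the adjoint part of the gradient leaves only the
  linearization error there. The penalty contributes the Bregman distance.\<close>

lemma tikhonov_remainder:
  fixes F :: "(nat \<Rightarrow> real) \<Rightarrow> 'y::real_inner"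
  assumes p: "1 < p" and q: "1 / p + 1 / q = 1" and T: "lp_bounded_linear p (F' x)"
    and x: "x \<in> lp p" and z: "z \<in> lp p"
  shows "taylor_remainder (tikhonov p F yd \<alpha>) (tikhonov_grad p q F F' yd \<alpha>) z x
    = 1 / 2 * norm (F z - F x) ^ 2 + inner (F x - yd) (F z - F x - F' x (z - x))
      + \<alpha> * bregman p z x"
proof -
  have zx: "z - x \<in> lp p" using lp_diff[OF _ z x] p by simp
  \<comment> \<open>\<open>pairing\<close> is an infinite sum, so it splits over the two parts of
    the gradient only once both series are known to converge.\<close>
  have "(\<lambda>i. lp_adjoint p q (F' x) (F x - yd) i * (z - x) i + \<alpha> * (J_dual p x i * (z - x) i))
      sums (inner (F x - yd) (F' x (z - x)) + \<alpha> * pairing (J_dual p x) (z - x))"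
    unfolding pairing_def
    by (intro sums_add sums_mult lp_adjoint_sums[OF p q T zx] summable_sums
        J_dual_pairing_summable[OF p x zx])
  then have "pairing (tikhonov_grad p q F F' yd \<alpha> x) (z - x)
      = inner (F x - yd) (F' x (z - x)) + \<alpha> * pairing (J_dual p x) (z - x)"
    by (simp add: pairing_def tikhonov_grad_def sums_iff algebra_simps)
  moreover have "norm (F z - yd) ^ 2 = norm (F z - F x) ^ 2 + norm (F x - yd) ^ 2
      + 2 * inner (F x - yd) (F z - F x)"
    by (simp add: power2_norm_eq_inner inner_diff_left inner_diff_right inner_commute)
  ultimately show ?thesis
    by (simp add: taylor_remainder_def bregman_def tikhonov_eq inner_diff_right algebra_simps)
qed

lemma tikhonov_remainder_ge:
  fixes F :: "(nat \<Rightarrow> real) \<Rightarrow> 'y::real_inner"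
  assumes "1 < p" "1 / p + 1 / q = 1" "lp_bounded_linear p (F' x)" "x \<in> lp p" "z \<in> lp p"
    and c: "norm (F z - F x - F' x (z - x)) \<le> c * bregman p z x"
  shows "taylor_remainder (tikhonov p F yd \<alpha>) (tikhonov_grad p q F F' yd \<alpha>) z x
    \<ge> (\<alpha> - c * norm (F x - yd)) * bregman p z x"
proof -
  let ?E = "F z - F x - F' x (z - x)"
  have "- inner (F x - yd) ?E \<le> norm (F x - yd) * norm ?E"
    using Cauchy_Schwarz_ineq2[of "F x - yd" ?E] by linarith
  also have "\<dots> \<le> norm (F x - yd) * (c * bregman p z x)"
    using c by (intro mult_left_mono) auto
  finally have "- inner (F x - yd) ?E \<le> norm (F x - yd) * (c * bregman p z x)" .
  moreover have "norm (F z - F x) ^ 2 \<ge> 0" by simp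
  moreover have "(\<alpha> - c * norm (F x - yd)) * bregman p z x
      = \<alpha> * bregman p z x - norm (F x - yd) * (c * bregman p z x)"
    by (simp add: algebra_simps)
  ultimately show ?thesis
    unfolding tikhonov_remainder[where F' = F', OF assms(1-5)] by linarith
qed

text \<open>Minimality compares \<open>xa\<close> with \<open>xd\<close>. The source condition turns
  the linear term of the Bregman distance into an inner product with \<open>\<omega>\<close>, whose
  other factor is \<open>F xa - F xd\<close> up to the linearization error. What remains is a
  quadratic inequality for the residual.\<close>

lemma tikhonov_residual_le:
  fixes F :: "(nat \<Rightarrow> real) \<Rightarrow> 'y::real_inner"
  assumes p: "1 < p" and q: "1 / p + 1 / q = 1"
    and T: "lp_bounded_linear p (F' xd)"
    and yd: "norm (y - yd) \<le> \<delta>"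
    and xd: "xd \<in> lp p" "F xd = y"
    and \<omega>: "norm \<omega> \<le> \<rho>" "J_dual p xd = lp_adjoint p q (F' xd) \<omega>"
    and c: "norm (F xa - F xd - F' xd (xa - xd)) \<le> c * bregman p xa xd"
    and c\<rho>: "c > 0" "c * \<rho> \<le> 1" and \<alpha>: "\<alpha> > 0"
    and xa: "tikhonov_minimizer p F yd \<alpha> xa"
  shows "norm (F xa - yd) \<le> \<delta> + 2 * \<alpha> * \<rho>"
proof -
  let ?e = "norm (F xa - yd)" and ?D = "bregman p xa xd"
  let ?E = "F xa - F xd - F' xd (xa - xd)"
  have xal: "xa \<in> lp p" and min: "tikhonov p F yd \<alpha> xa \<le> tikhonov p F yd \<alpha> xd"
    using xa xd by (auto simp: tikhonov_minimizer_def)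
  have \<rho>0: "\<rho> \<ge> 0" using \<omega>(1) norm_ge_zero order_trans by blast
  have \<delta>0: "\<delta> \<ge> 0" using yd norm_ge_zero order_trans by blast
  \<comment> \<open>Nonnegativity is read off the nonlinearity condition: a norm is at most
    \<open>c\<close> times the distance, and \<open>c\<close> is positive.\<close>
  have D0: "?D \<ge> 0"
    using c c\<rho>(1) norm_ge_zero[of ?E] by (smt (verit) zero_le_mult_iff)
  have mem: "xa - xd \<in> lp p" using lp_diff[OF _ xal xd(1)] p by simp
  have pair: "pairing (J_dual p xd) (xa - xd) = inner \<omega> (F' xd (xa - xd))"
    unfolding pairing_def \<omega>(2) by (rule sums_unique[OF lp_adjoint_sums[OF p q T mem], symmetric])
  have "- inner \<omega> (F' xd (xa - xd)) \<le> norm \<omega> * norm (F' xd (xa - xd))"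
    using Cauchy_Schwarz_ineq2[of \<omega> "F' xd (xa - xd)"] by linarith
  also have "\<dots> \<le> \<rho> * (?e + \<delta> + c * ?D)"
  proof (intro mult_mono)
    have "norm (F' xd (xa - xd)) = norm ((F xa - yd) - (y - yd) - ?E)" using xd by simp
    then have "norm (F' xd (xa - xd)) \<le> ?e + norm (y - yd) + norm ?E"
      using norm_triangle_ineq4[of "(F xa - yd) - (y - yd)" ?E]
        norm_triangle_ineq4[of "F xa - yd" "y - yd"] by linarith
    then show "norm (F' xd (xa - xd)) \<le> ?e + \<delta> + c * ?D"
      using yd c by linarith
  qed (use \<omega> \<rho>0 in auto)
  finally have "\<alpha> * (- inner \<omega> (F' xd (xa - xd))) \<le> \<alpha> * (\<rho> * (?e + \<delta> + c * ?D))"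
    using \<alpha> by (intro mult_left_mono) auto
  moreover have "norm (y - yd) ^ 2 \<le> \<delta> ^ 2"
    using yd by (intro power_mono) auto
  moreover have "1 / 2 * ?e ^ 2 + \<alpha> * f_pen p xa \<le> 1 / 2 * norm (y - yd) ^ 2 + \<alpha> * f_pen p xd"
    using min xd by (simp add: tikhonov_eq)
  moreover have "\<alpha> * ?D = \<alpha> * f_pen p xa - \<alpha> * f_pen p xd - \<alpha> * inner \<omega> (F' xd (xa - xd))"
    by (simp add: bregman_def taylor_remainder_def pair algebra_simps)
  \<comment> \<open>The Bregman term produced by the linearization error is thereby absorbed into
    the one coming from minimality.\<close>
  moreover have "\<alpha> * ?D * (c * \<rho>) \<le> \<alpha> * ?D * 1"
    using D0 \<alpha> c\<rho> by (intro mult_left_mono) auto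
  ultimately have "?e ^ 2 \<le> \<delta> ^ 2 + 2 * \<alpha> * \<rho> * (?e + \<delta>)"
    by (simp add: algebra_simps)
  \<comment> \<open>Completing the square: both sides gain the square of
    \<open>\<alpha> * \<rho>\<close>.\<close>
  then have "(?e - \<alpha> * \<rho>) ^ 2 \<le> (\<delta> + \<alpha> * \<rho>) ^ 2"
    by (simp add: power2_eq_square algebra_simps)
  then have "?e - \<alpha> * \<rho> \<le> \<delta> + \<alpha> * \<rho>"
    by (rule power2_le_imp_le) (use \<delta>0 \<rho>0 \<alpha> in auto)
  then show ?thesis by simp
qed

text \<open>Comparison with the zero sequence, discarding the residual of \<open>xa\<close>. For
  \<alpha> = \<open>\<alpha>s\<close> the bound is the constant \<open>A\<close> of the
  theorem.\<close>

lemma tikhonov_minimizer_norm_le: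
  assumes "p > 0" "\<alpha> > 0" "tikhonov_minimizer p F yd \<alpha> xa"
  shows "lp_norm p xa \<le> (p / (2 * \<alpha>)) powr (1 / p) * norm (F (\<lambda>_. 0) - yd) powr (2 / p)"
proof -
  let ?N = "norm (F (\<lambda>_. 0) - yd)"
  have "tikhonov p F yd \<alpha> xa \<le> tikhonov p F yd \<alpha> (\<lambda>_. 0)"
    using assms(3) by (simp add: tikhonov_minimizer_def)
  then have "\<alpha> / p * lp_norm p xa powr p \<le> 1 / 2 * ?N ^ 2"
    by (simp add: tikhonov_def) (smt (verit) zero_le_power2)
  then have "lp_norm p xa powr p \<le> p / (2 * \<alpha>) * ?N ^ 2"
    using assms by (simp add: field_simps)
  then have "(lp_norm p xa powr p) powr (1 / p) \<le> (p / (2 * \<alpha>) * ?N ^ 2) powr (1 / p)"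
    using assms by (intro powr_mono2) auto
  moreover have "(?N ^ 2) powr (1 / p) = ?N powr (2 / p)"
    by (cases "?N = 0") (simp_all add: powr_powr flip: powr_numeral)
  moreover have "(p / (2 * \<alpha>) * ?N ^ 2) powr (1 / p) = (p / (2 * \<alpha>)) powr (1 / p) * (?N ^ 2) powr (1 / p)"
    using assms by (intro powr_mult)
  ultimately show ?thesis
    using assms(1) by (simp add: powr_powr)
qed

text \<open>The sequence space is a carrier set, not a type; restriction to a line turns its
  derivative into \<open>has_derivative\<close> on the reals, where the mean value inequality is
  available.\<close>

lemma lp_line_has_derivative:
  assumes "p > 0" "x \<in> lp p" "h \<in> lp p"
    and deriv: "lp_has_derivative p F T (\<lambda>i. x i + t * h i)"
  shows "((\<lambda>t. F (\<lambda>i. x i + t * h i)) has_derivative (\<lambda>s. s *\<^sub>R T h)) (at t)"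
proof -
  let ?x = "\<lambda>t i. x i + t * h i"
  have T: "lp_bounded_linear p T"
    using deriv by (simp add: lp_has_derivative_def)
  have mem: "?x t \<in> lp p" for t
    using lp_add[OF assms(1,2) lp_scale[OF assms(3)]] .
  have diff: "?x u - ?x t = (\<lambda>i. (u - t) * h i)" for u
    by (auto simp: algebra_simps)
  have N: "lp_norm p (?x u - ?x t) = \<bar>u - t\<bar> * lp_norm p h" for u
    unfolding diff by (rule lp_norm_scale[OF assms(1,3)])
  have Th: "T (?x u - ?x t) = (u - t) *\<^sub>R T h" for u
    unfolding diff by (rule lp_bounded_linear_scale[OF T assms(3)])
  have "\<exists>d>0. \<forall>u. norm (u - t) < d \<longrightarrow>
      norm (F (?x u) - F (?x t) - (u - t) *\<^sub>R T h) \<le> \<epsilon> * norm (u - t)" if "\<epsilon> > 0" for \<epsilon>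
  proof -
    \<comment> \<open>Adding 1 keeps the divisor positive even if \<open>h\<close> has norm
      0.\<close>
    define C where "C = lp_norm p h + 1"
    have C: "C > 0" "lp_norm p h \<le> C" by (auto simp: C_def add_nonneg_pos)
    obtain d where d: "d > 0" "\<And>z. z \<in> lp p \<Longrightarrow> lp_norm p (z - ?x t) < d \<Longrightarrow>
        norm (F z - F (?x t) - T (z - ?x t)) \<le> \<epsilon> / C * lp_norm p (z - ?x t)"
      using deriv divide_pos_pos[OF \<open>\<epsilon> > 0\<close> C(1)] unfolding lp_has_derivative_def by blast
    have "norm (F (?x u) - F (?x t) - (u - t) *\<^sub>R T h) \<le> \<epsilon> * norm (u - t)"
      if "norm (u - t) < d / C" for u
    proof -
      have le: "\<bar>u - t\<bar> * lp_norm p h \<le> \<bar>u - t\<bar> * C"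
        using C by (intro mult_left_mono) auto
      have "\<bar>u - t\<bar> * C < d" using that C by (simp add: field_simps)
      then have "norm (F (?x u) - F (?x t) - (u - t) *\<^sub>R T h) \<le> \<epsilon> / C * (\<bar>u - t\<bar> * lp_norm p h)"
        using d(2)[OF mem] le unfolding N Th by simp
      also have "\<dots> \<le> \<epsilon> / C * (\<bar>u - t\<bar> * C)"
        using le \<open>\<epsilon> > 0\<close> C by (intro mult_left_mono) auto
      also have "\<dots> = \<epsilon> * norm (u - t)" using C by simp
      finally show ?thesis .
    qed
    then show ?thesis using d C by (intro exI[of _ "d / C"]) auto
  qed
  then show ?thesis
    unfolding has_derivative_at_alt by (auto intro: bounded_linear_scaleR_left)
qed

text \<open>Mean value inequality on [-r, r]: the derivative at \<open>u\<close> is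
  \<open>F' (?x u) h\<close>, which the Lipschitz condition keeps within \<open>L * r\<close> of
  \<open>F' x h\<close>.\<close>

lemma lp_line_increment_le:
  fixes F :: "(nat \<Rightarrow> real) \<Rightarrow> 'y::real_normed_vector"
  assumes p: "p > 0" and x: "x \<in> lp p" and h: "h \<in> lp p" "lp_norm p h = 1"
    and deriv: "\<forall>x\<in>lp p. lp_has_derivative p F (F' x) x"
    and L: "\<forall>x\<in>lp p. \<forall>z\<in>lp p. lp_onorm p (\<lambda>h. F' x h - F' z h) \<le> L * lp_norm p (x - z)"
      "L \<ge> 0"
    and t: "\<bar>t\<bar> \<le> r"
  shows "norm (F (\<lambda>i. x i + t * h i) - F x) \<le> (lp_onorm p (F' x) + L * r) * r"
proof -
  let ?x = "\<lambda>t i. x i + t * h i"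
  let ?K = "lp_onorm p (F' x) + L * r"
  have mem: "?x t \<in> lp p" for t
    using lp_add[OF p x lp_scale[OF h(1)]] .
  have lin: "lp_bounded_linear p (F' x)" if "x \<in> lp p" for x
    using deriv that by (simp add: lp_has_derivative_def)
  have r: "r \<ge> 0" using t by linarith
  have K: "?K \<ge> 0"
    using lp_onorm_nonneg[OF lin[OF x]] L r by simp
  have bound: "norm (F' (?x u) h) \<le> ?K" if "\<bar>u\<bar> \<le> r" for u
  proof -
    have d: "?x u - x = (\<lambda>i. u * h i)" by auto
    have "norm (F' (?x u) h - F' x h) \<le> lp_onorm p (\<lambda>h. F' (?x u) h - F' x h)"
      using lp_onorm_bound[OF p lp_bounded_linear_diff[OF lin[OF mem] lin[OF x]] h(1)] h(2) by simp
    also have "\<dots> \<le> L * \<bar>u\<bar>"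
      using L(1) mem x lp_norm_scale[OF p h(1), of u] h(2) d by (metis mult.right_neutral)
    also have "\<dots> \<le> L * r" using that L by (intro mult_left_mono)
    finally have "norm (F' (?x u) h - F' x h) \<le> L * r" .
    moreover have "norm (F' x h) \<le> lp_onorm p (F' x)"
      using lp_onorm_bound[OF p lin[OF x] h(1)] h(2) by simp
    ultimately show ?thesis
      using norm_triangle_sub[of "F' (?x u) h" "F' x h"] by linarith
  qed
  have d: "((\<lambda>u. F (?x u)) has_derivative (\<lambda>s. s *\<^sub>R F' (?x u) h)) (at u within {-r..r})" for u
    by (rule has_derivative_at_withinI, rule lp_line_has_derivative[OF p x h(1)])
      (use deriv mem in blast)
  have b: "onorm (\<lambda>s. s *\<^sub>R F' (?x u) h) \<le> ?K" if "u \<in> {-r..r}" for u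
  proof (rule onorm_bound[OF K])
    fix s
    have "\<bar>u\<bar> \<le> r" using that by auto
    then show "norm (s *\<^sub>R F' (?x u) h) \<le> ?K * norm s"
      using mult_left_mono[OF bound[of u], of "\<bar>s\<bar>"] by (simp add: mult.commute)
  qed
  have "t \<in> {-r..r}" "0 \<in> {-r..r}" using t r by auto
  then have "norm (F (?x t) - F (?x 0)) \<le> ?K * norm (t - 0)"
    using differentiable_bound[OF convex_real_interval(5) d b] by blast
  also have "\<dots> \<le> ?K * r"
    using K t by (intro mult_left_mono) auto
  finally show ?thesis by simp
qed

text \<open>The supporting line at the intermediate point \<open>m\<close> lies below
  \<open>\<phi>\<close> at both endpoints, and the weighted mean of its two values there is
  \<open>\<phi> m\<close>.\<close>

lemma convex_on_supporting_lines:
  fixes \<phi> g :: "real \<Rightarrow> real"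
  assumes S: "convex S" and g: "\<And>s t. s \<in> S \<Longrightarrow> t \<in> S \<Longrightarrow> \<phi> t \<ge> \<phi> s + g s * (t - s)"
  shows "convex_on S \<phi>"
proof (rule convex_onI[OF _ S])
  fix u a b :: real assume u: "0 < u" "u < 1" and ab: "a \<in> S" "b \<in> S"
  define m where "m = (1 - u) *\<^sub>R a + u *\<^sub>R b"
  have m: "m \<in> S" unfolding m_def using S ab u by (intro convexD) auto
  have "(1 - u) * \<phi> a \<ge> (1 - u) * (\<phi> m + g m * (a - m))" "u * \<phi> b \<ge> u * (\<phi> m + g m * (b - m))"
    using g[OF m] ab u by (auto intro!: mult_left_mono)
  moreover have "(1 - u) * (\<phi> m + g m * (a - m)) + u * (\<phi> m + g m * (b - m)) = \<phi> m"
    by (simp add: m_def algebra_simps)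
  ultimately show "\<phi> ((1 - u) *\<^sub>R a + u *\<^sub>R b) \<le> (1 - u) * \<phi> a + u * \<phi> b"
    unfolding m_def by linarith
qed

theorem theorem3p2:
  fixes p q \<delta> L c s \<rho> \<gamma> \<alpha>s A K \<alpha> r :: real
    and F :: "(nat \<Rightarrow> real) \<Rightarrow> 'y::{real_inner,complete_space}"
    and F' :: "(nat \<Rightarrow> real) \<Rightarrow> (nat \<Rightarrow> real) \<Rightarrow> 'y"
    and y yd \<omega> :: 'y
    and xdag xa :: "nat \<Rightarrow> real"
  assumes p: "1 < p" "p \<le> 2"
    and q: "1 / p + 1 / q = 1"
    and closed: "weakly_seq_closed p q F"
    and y: "y \<in> F ` lp p"
    and \<delta>: "\<delta> > 0"
    and yd: "norm (y - yd) \<le> \<delta>"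
    and deriv: "\<forall>x\<in>lp p. lp_has_derivative p F (F' x) x"
    and L: "L > 0"
      "\<forall>x\<in>lp p. \<forall>z\<in>lp p. lp_onorm p (\<lambda>h. F' x h - F' z h) \<le> L * lp_norm p (x - z)"
    and c: "c > 0"
      "\<forall>x\<in>lp p. \<forall>z\<in>lp p. norm (F x - F z - F' z (x - z)) \<le> c * bregman p x z"
    and s: "s > 2"
    and \<rho>: "0 < \<rho>" "\<rho> < 1 / (s * c)"
    and xdag: "minimizing_solution p F y xdag"
    and \<omega>: "norm \<omega> \<le> \<rho>" "J_dual p xdag = lp_adjoint p q (F' xdag) \<omega>"
    and \<gamma>: "\<gamma> = (1 - s * c * \<rho>) / 2"
    and \<alpha>s: "\<alpha>s = \<delta> / ((s - 2) * \<rho>)"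
    and A: "A = (p / (2 * \<alpha>s)) powr (1 / p) * norm (F (\<lambda>_. 0) - yd) powr (2 / p)"
    and K: "K = L * A + lp_onorm p (F' (\<lambda>_. 0))"
    and \<alpha>: "\<alpha> \<ge> \<alpha>s"
    and r: "r = 2 / (1 + sqrt 2) *
      (if K = 0 then sqrt (\<gamma> * \<alpha> / (10 * c * L))
       else min (\<gamma> * \<alpha> / (3 * c * K)) (sqrt (\<gamma> * \<alpha> / (10 * c * L))))"
    and xa: "tikhonov_minimizer p F yd \<alpha> xa"
  shows "\<forall>h\<in>lp p. lp_norm p h = 1 \<longrightarrow>
    (\<forall>t1 t2. \<bar>t1\<bar> \<le> r \<longrightarrow> \<bar>t2\<bar> \<le> r \<longrightarrow>
       taylor_remainder (tikhonov p F yd \<alpha>) (tikhonov_grad p q F F' yd \<alpha>)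
         (\<lambda>i. xa i + t2 * h i) (\<lambda>i. xa i + t1 * h i)
       \<ge> \<gamma> * \<alpha> * bregman p (\<lambda>i. xa i + t2 * h i) (\<lambda>i. xa i + t1 * h i)) \<and>
    convex_on {- r..r} (\<lambda>t. tikhonov p F yd \<alpha> (\<lambda>i. xa i + t * h i))"
proof -
  have p0: "p > 0" using p by simp
  have lin: "lp_bounded_linear p (F' x)" if "x \<in> lp p" for x
    using deriv that by (simp add: lp_has_derivative_def)
  have xal: "xa \<in> lp p" using xa by (simp add: tikhonov_minimizer_def)
  have xd: "xdag \<in> lp p" "F xdag = y" using xdag by (auto simp: minimizing_solution_def)
  have sc\<rho>: "s * c * \<rho> < 1" using \<rho> s c(1) by (simp add: field_simps)
  have \<gamma>0: "\<gamma> > 0" using sc\<rho> \<gamma> by simp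
  have \<alpha>s0: "\<alpha>s > 0" using \<alpha>s \<delta> s \<rho> by simp
  have \<alpha>0: "\<alpha> > 0" using \<alpha>s0 \<alpha> by simp
  have \<gamma>\<alpha>: "\<gamma> * \<alpha> > 0" using \<gamma>0 \<alpha>0 by simp
  have breg: "bregman p z x \<ge> 0" if "x \<in> lp p" "z \<in> lp p" for x z
  proof -
    have "0 \<le> c * bregman p z x" using c(2) that norm_ge_zero order_trans by blast
    then show ?thesis using c(1) by (simp add: zero_le_mult_iff)
  qed

  \<comment> \<open>The residual at the minimizer\<close>
  have "c * \<rho> \<le> s * (c * \<rho>)" using s c(1) \<rho>(1) by simp
  then have c\<rho>: "c * \<rho> \<le> 1" using sc\<rho> by (simp add: mult.assoc)
  have "norm (F xa - yd) \<le> \<delta> + 2 * \<alpha> * \<rho>"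
    using tikhonov_residual_le[where c = c and F' = F', OF p(1) q lin[OF xd(1)] yd xd \<omega> _ c(1) c\<rho> \<alpha>0 xa]
      c(2) xal xd(1) by blast
  \<comment> \<open>This is \<open>\<alpha> \<ge> \<alpha>s\<close> with the denominator cleared;
    the term 2 \<alpha> \<rho> then completes (s - 2) to s.\<close>
  moreover have "\<delta> \<le> \<alpha> * ((s - 2) * \<rho>)"
    using \<alpha> \<alpha>s s \<rho> by (simp add: field_simps)
  ultimately have "norm (F xa - yd) \<le> \<alpha> * s * \<rho>" by (simp add: algebra_simps)
  then have "c * norm (F xa - yd) \<le> c * (\<alpha> * s * \<rho>)"
    using c(1) by (intro mult_left_mono) auto
  \<comment> \<open>\<gamma> is half of the slack 1 - s c \<rho>: one half pays for moving along the
    line, the other survives as the factor in the conclusion.\<close>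
  moreover have "2 * \<gamma> = 1 - s * c * \<rho>" by (simp add: \<gamma>)
  ultimately have res: "c * norm (F xa - yd) \<le> (1 - 2 * \<gamma>) * \<alpha>" by (simp add: mult_ac)

  \<comment> \<open>Bounds for the minimizer and for the derivative there\<close>
  have A0: "A \<ge> 0" by (simp add: A)
  have K0: "K \<ge> 0" using A0 L lp_onorm_nonneg[OF lin[OF lp_zero]] by (simp add: K)
  have xaA: "lp_norm p xa \<le> A"
  proof -
    \<comment> \<open>The norm bound decreases in \<alpha>, so its value at \<open>\<alpha>s\<close>
      serves for every larger parameter.\<close>
    have "(p / (2 * \<alpha>)) powr (1 / p) \<le> (p / (2 * \<alpha>s)) powr (1 / p)"
      using \<alpha> \<alpha>s0 p by (intro powr_mono2) (auto intro!: divide_left_mono)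
    then show ?thesis
      using tikhonov_minimizer_norm_le[OF p0 \<alpha>0 xa] unfolding A
      by (meson mult_right_mono order_trans powr_ge_zero)
  qed
  have xaK: "lp_onorm p (F' xa) \<le> K"
    unfolding lp_onorm_def
  proof (rule cSUP_least)
    have "(\<lambda>_. 0) \<in> {x \<in> lp p. lp_norm p x \<le> 1}" by simp
    then show "{x \<in> lp p. lp_norm p x \<le> 1} \<noteq> {}" by blast
    fix h assume h: "h \<in> {x \<in> lp p. lp_norm p x \<le> 1}"
    let ?U = "\<lambda>h. F' xa h - F' (\<lambda>_. 0) h"
    \<comment> \<open>The Lipschitz condition between \<open>xa\<close> and 0, which are at distance
      at most \<open>A\<close>; this is the source of the summand \<open>L * A\<close> in
      \<open>K\<close>.\<close>
    have 1: "lp_onorm p ?U \<le> L * A"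
    proof -
      have "lp_onorm p ?U \<le> L * lp_norm p (xa - (\<lambda>_. 0))" using L(2) xal lp_zero by blast
      also have "\<dots> \<le> L * A" using xaA L(1) by (simp add: fun_diff_def)
      finally show ?thesis .
    qed
    have le: "norm (T h) \<le> lp_onorm p T" if "lp_bounded_linear p T"
      for T :: "(nat \<Rightarrow> real) \<Rightarrow> 'y"
      unfolding lp_onorm_def using lp_onorm_bdd[OF that] h by (intro cSUP_upper)
    have "norm (F' xa h) \<le> norm (F' (\<lambda>_. 0) h) + norm (?U h)"
      by (rule norm_triangle_sub)
    also have "\<dots> \<le> K"
      using le[OF lin[OF lp_zero]] le[OF lp_bounded_linear_diff[OF lin[OF xal] lin[OF lp_zero]]] 1
      by (simp add: K)
    finally show "norm (F' xa h) \<le> K" .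
  qed

  \<comment> \<open>Consequences of the choice of the radius\<close>
  define m where "m = (if K = 0 then sqrt (\<gamma> * \<alpha> / (10 * c * L))
       else min (\<gamma> * \<alpha> / (3 * c * K)) (sqrt (\<gamma> * \<alpha> / (10 * c * L))))"
  have m0: "m \<ge> 0" unfolding m_def using \<gamma>\<alpha> c(1) L(1) K0 by auto
  have rm: "r \<le> m" "r \<ge> 0"
  proof -
    \<comment> \<open>The factor 2 / (1 + sqrt 2) is below 1, so \<open>r\<close> inherits the upper
      bounds on \<open>m\<close>.\<close>
    have "1 \<le> sqrt (2 :: real)" by simp
    then have "2 / (1 + sqrt 2) \<le> (1 :: real)" by (subst divide_le_eq_1_pos) linarith+
    then have "2 / (1 + sqrt 2) * m \<le> 1 * m" using m0 by (intro mult_right_mono)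
    then show "r \<le> m" by (simp add: r m_def)
    show "r \<ge> 0" using m0 by (simp add: r flip: m_def)
  qed
  \<comment> \<open>For \<open>K = 0\<close> the left side vanishes. That case is kept out of the
    minimum because division by 0 yields 0 and would collapse the radius instead of giving an
    infinite quotient.\<close>
  have "c * K * r \<le> \<gamma> * \<alpha> / 3"
  proof (cases "K = 0")
    case False
    then have "r \<le> \<gamma> * \<alpha> / (3 * c * K)" using rm by (simp add: m_def)
    then show ?thesis using False K0 c(1) by (simp add: field_simps)
  qed (use \<gamma>\<alpha> in simp)
  moreover have "c * L * r ^ 2 \<le> \<gamma> * \<alpha> / 10"
  proof -
    have "r \<le> sqrt (\<gamma> * \<alpha> / (10 * c * L))" using rm by (auto simp: m_def split: if_splits)
    then have "r ^ 2 \<le> (sqrt (\<gamma> * \<alpha> / (10 * c * L))) ^ 2" using rm by (intro power_mono)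
    also have "\<dots> = \<gamma> * \<alpha> / (10 * c * L)" using \<gamma>\<alpha> c(1) L(1) by simp
    finally show ?thesis using c(1) L(1) by (simp add: field_simps)
  qed
  \<comment> \<open>The two shares add up to (1/3 + 1/10) \<gamma> \<alpha>, which is below \<gamma>
    \<alpha>.\<close>
  ultimately have inc: "c * ((K + L * r) * r) \<le> \<gamma> * \<alpha>"
    using \<gamma>\<alpha> by (simp add: algebra_simps power2_eq_square)

  \<comment> \<open>The inequality and convexity along one line\<close>
  show ?thesis
  proof (intro ballI impI)
    fix h assume h: "h \<in> lp p" "lp_norm p h = 1"
    let ?x = "\<lambda>t i. xa i + t * h i"
    let ?R = "\<lambda>z x. taylor_remainder (tikhonov p F yd \<alpha>) (tikhonov_grad p q F F' yd \<alpha>) z x"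
    have mem: "?x t \<in> lp p" for t using lp_add[OF p0 xal lp_scale[OF h(1)]] .
    have main: "?R (?x t2) (?x t1) \<ge> \<gamma> * \<alpha> * bregman p (?x t2) (?x t1)" if "\<bar>t1\<bar> \<le> r" for t1 t2
    proof -
      have "norm (F (?x t1) - F xa) \<le> (lp_onorm p (F' xa) + L * r) * r"
        using lp_line_increment_le[OF p0 xal h deriv L(2) _ that] L(1) by simp
      also have "\<dots> \<le> (K + L * r) * r" using xaK rm by (intro mult_right_mono) auto
      finally have "norm (F (?x t1) - yd) \<le> norm (F xa - yd) + (K + L * r) * r"
        using norm_triangle_ineq[of "F xa - yd" "F (?x t1) - F xa"] by simp
      then have "c * norm (F (?x t1) - yd) \<le> c * (norm (F xa - yd) + (K + L * r) * r)"
        using c(1) by simp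
      \<comment> \<open>The minimizer accounts for (1 - 2 \<gamma>) \<alpha> and the displacement
        for at most \<gamma> \<alpha>.\<close>
      also have "\<dots> \<le> (1 - \<gamma>) * \<alpha>" using res inc by (simp add: algebra_simps)
      finally have "\<gamma> * \<alpha> \<le> \<alpha> - c * norm (F (?x t1) - yd)" by (simp add: algebra_simps)
      then have "\<gamma> * \<alpha> * bregman p (?x t2) (?x t1)
          \<le> (\<alpha> - c * norm (F (?x t1) - yd)) * bregman p (?x t2) (?x t1)"
        using breg[OF mem mem] by (intro mult_right_mono)
      also have "\<dots> \<le> ?R (?x t2) (?x t1)"
        by (rule tikhonov_remainder_ge[where F' = F', OF p(1) q lin[OF mem] mem mem]) (use c(2) mem in blast)
      finally show ?thesis .
    qed
    moreover have "convex_on {- r..r} (\<lambda>t. tikhonov p F yd \<alpha> (?x t))"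
    proof (rule convex_on_supporting_lines)
      fix t1 t2 assume t: "t1 \<in> {- r..r}" "t2 \<in> {- r..r}"
      let ?g = "tikhonov_grad p q F F' yd \<alpha> (?x t1)"
      \<comment> \<open>Convergence permits drawing the factor \<open>t2 - t1\<close> out of the
        pairing, which exhibits \<open>pairing ?g h\<close> as the slope of the supporting line at
        \<open>t1\<close>.\<close>
      have "summable (\<lambda>i. lp_adjoint p q (F' (?x t1)) (F (?x t1) - yd) i * h i
          + \<alpha> * (J_dual p (?x t1) i * h i))"
        using lp_adjoint_sums[OF p(1) q lin[OF mem[of t1]] h(1)] J_dual_pairing_summable[OF p(1) mem h(1)]
        by (intro summable_add summable_mult) (auto simp: sums_iff)
      then have "summable (\<lambda>i. ?g i * h i)"
        by (simp add: tikhonov_grad_def algebra_simps)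
      then have "pairing ?g (?x t2 - ?x t1) = pairing ?g h * (t2 - t1)"
        unfolding pairing_def by (subst suminf_mult2) (auto simp: algebra_simps)
      moreover have "?R (?x t2) (?x t1) \<ge> 0"
        using main[of t1 t2] t \<gamma>\<alpha> breg[OF mem mem, of t2 t1]
        by (smt (verit) atLeastAtMost_iff mult_nonneg_nonneg)
      ultimately show "tikhonov p F yd \<alpha> (?x t2)
          \<ge> tikhonov p F yd \<alpha> (?x t1) + pairing ?g h * (t2 - t1)"
        by (simp add: taylor_remainder_def)
    qed simp
    ultimately show "(\<forall>t1 t2. \<bar>t1\<bar> \<le> r \<longrightarrow> \<bar>t2\<bar> \<le> r \<longrightarrow>
       ?R (?x t2) (?x t1) \<ge> \<gamma> * \<alpha> * bregman p (?x t2) (?x t1)) \<and>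
      convex_on {- r..r} (\<lambda>t. tikhonov p F yd \<alpha> (?x t))"
      by blast
  qed
qed

end
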